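(* Let $(M,\lambda,J)$ be a contact triad and let $\nabla$ be an affine connection on $M$ satisfying axioms (1)–(5) listed in the context. Let $\alpha^0_k$, $k=1,\dots,n$, be the associated connection one-forms in an almost contact frame, decomposed as $$\alpha^0_k=\alpha_k^{0\pi}+\alpha_k^{0\perp}=(\alpha_k^{0\pi})^{(1,0)}+(\alpha_k^{0\pi})^{(0,1)}+\alpha_k^{0\perp}$$ according to $T^*M\otimes\mathbb{C}=\xi^{*(1,0)}\oplus\xi^{*(0,1)}\oplus\mathbb{C}\langle\lambda\rangle$. Then $\alpha_k^{0\perp}=0$ for all $k=1,\dots,n$, and the condition $$\nabla_{JY}R_\lambda+J\nabla_YR_\lambda=0\quad\text{for all }Y\in\xi$$ is equivalent to $$(\alpha_k^{0\pi})^{(1,0)}=0\quad\text{for all }k=1,\dots,n,$$ i.e. to each $\alpha_k^{0\pi}$ being anti-holomorphic.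
   Context: Contact triad: $M$ is a smooth manifold of dimension $2n+1$, $\lambda$ is a contact form, $\xi=\ker\lambda$, $R_\lambda$ is the Reeb vector field ($\lambda(R_\lambda)=1$, $d\lambda(R_\lambda,\cdot)=0$), $TM=\xi\oplus\mathbb{R}\langle R_\lambda\rangle$ with projection $\pi:TM\to\xi$. $J:\xi\to\xi$ satisfies $J^2=-\mathrm{id}$ and $g_\xi=d\lambda(\cdot,J\cdot)|_\xi$ makes $(\xi,J,g_\xi)$ a Hermitian vector bundle; $J$ is extended to $TM$ by $J(R_\lambda)=0$. The triad metric is $g=d\lambda(\cdot,J\cdot)+\lambda\otimes\lambda$. The torsion is $T(X,Y)=\nabla_XY-\nabla_YX-[X,Y]$. Axioms: (1) $\nabla g=0$. (2) $T(R_\lambda,Y)=0$ for all $Y\in TM$. (3) $\nabla_{R_\lambda}R_\lambda=0$ and $\nabla_YR_\lambda\in\xi$ for $Y\in\xi$. (4) $\nabla^\pi:=\pi\nabla|_\xi$ is a Hermitian connection of $\xi\to M$ with Hermitian structure $(d\lambda,J)$. (5) $T^\pi:=\pi T$ satisfies $T^\pi(JY,Y)=0$ for all $Y\in\xi$. Almost contact frame: take a local orthonormal Darboux frame $E_1,\dots,E_n,F_1,\dots,F_n,R_\lambda$ of $TM$ with $E_i\in\xi$, $F_i=JE_i$, and dual coframe $e^i,f^i,\lambda$. Put $\eta_i=\frac1{\sqrt2}(E_i-\sqrt{-1}F_i)$, $\theta^i=\frac1{\sqrt2}(e^i+\sqrt{-1}f^i)$. $\xi^{*(1,0)}$ is spanned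 by the $\theta^i$ and $\xi^{*(0,1)}$ by the $\overline\theta^i$. For a one-form $\gamma$, $\gamma^\perp=\gamma(R_\lambda)\lambda$ and $\gamma^\pi=\gamma-\gamma^\perp$. The connection one-forms $\alpha^0_k$ are the complex-valued one-forms with $$\nabla_YR_\lambda=\sum_{k=1}^n\alpha^0_k(Y)\,\eta_k+\sum_{k=1}^n\overline{\alpha^0_k(Y)}\;\overline{\eta_k}$$ for real vectors $Y$. *)

theory Defs
  imports "HOL-Analysis.Analysis" "HOL-Library.Function_Algebras"
begin

section \<open>Pointwise real vector space structure on functions\<close>

instantiation "fun" :: (type, real_vector) real_vector
begin

definition scaleR_fun_def: "c *\<^sub>R f = (\<lambda>x. c *\<^sub>R f x)"

instance
  by standard
    (auto simp: scaleR_fun_def fun_eq_iff scaleR_add_right scaleR_add_left)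

end


section \<open>Smooth manifolds\<close>

fun Ck_on :: "nat \<Rightarrow> 'e::euclidean_space set \<Rightarrow> ('e \<Rightarrow> 'f::real_normed_vector) \<Rightarrow> bool" where
  "Ck_on 0 S f \<longleftrightarrow> continuous_on S f"
| "Ck_on (Suc k) S f \<longleftrightarrow>
     (\<forall>x\<in>S. f differentiable (at x)) \<and>
     (\<forall>v. Ck_on k S (\<lambda>x. frechet_derivative f (at x) v))"

definition Cinf_on :: "'e::euclidean_space set \<Rightarrow> ('e \<Rightarrow> 'f::real_normed_vector) \<Rightarrow> bool" where
  "Cinf_on S f \<longleftrightarrow> (\<forall>k. Ck_on k S f)"

text \<open>The manifold is the whole (Hausdorff, second countable) type \<open>'a\<close>, with its smooth
  structure given by an atlas \<open>A\<close> that need not be maximal. A chart is a pair \<open>(D, \<phi>)\<close> of an open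
  domain and a map; the values of \<open>\<phi>\<close> outside \<open>D\<close> are irrelevant.\<close>

type_synonym ('a, 'e) chart = "'a set \<times> ('a \<Rightarrow> 'e)"

definition smooth_atlas ::
  "('a::{t2_space, second_countable_topology}, 'e::euclidean_space) chart set \<Rightarrow> bool" where
  "smooth_atlas A \<longleftrightarrow>
     (\<forall>(D, \<phi>)\<in>A. open D \<and> open (\<phi> ` D) \<and> (\<exists>\<psi>. homeomorphism D (\<phi> ` D) \<phi> \<psi>)) \<and>
     (\<Union>(D, \<phi>)\<in>A. D) = UNIV \<and>
     (\<forall>(D, \<phi>)\<in>A. \<forall>(D', \<phi>')\<in>A. Cinf_on (\<phi> ` (D \<inter> D')) (\<phi>' \<circ> inv_into D \<phi>))"

definition smooth_fun ::
  "('a::{t2_space, second_countable_topology}, 'e::euclidean_space) chart set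
     \<Rightarrow> 'a set \<Rightarrow> ('a \<Rightarrow> real) \<Rightarrow> bool" where
  "smooth_fun A U f \<longleftrightarrow> (\<forall>(D, \<phi>)\<in>A. Cinf_on (\<phi> ` (U \<inter> D)) (f \<circ> inv_into D \<phi>))"


section \<open>Tangent vectors, vector fields and one-forms\<close>

text \<open>Tangent vectors at \<open>p\<close> are the derivations at \<open>p\<close> of the algebra of globally defined smooth
  functions. They are normalised to be \<open>0\<close> on non-smooth functions, and covectors at \<open>p\<close> are
  normalised to be \<open>0\<close> outside the tangent space, so that equality of tangent vectors and of
  covectors is HOL equality. Vector fields and one-forms on an open set \<open>U\<close> are unconstrained at
  points outside \<open>U\<close>.\<close>

type_synonym 'a tvec = "('a \<Rightarrow> real) \<Rightarrow> real"
type_synonym 'a ctvec = "('a \<Rightarrow> real) \<Rightarrow> complex"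
type_synonym 'a vfield = "'a \<Rightarrow> 'a tvec"
type_synonym 'a form1 = "'a \<Rightarrow> 'a tvec \<Rightarrow> real"
type_synonym 'a cform1 = "'a \<Rightarrow> 'a tvec \<Rightarrow> complex"

definition tangent ::
  "('a::{t2_space, second_countable_topology}, 'e::euclidean_space) chart set
     \<Rightarrow> 'a \<Rightarrow> 'a tvec set" where
  "tangent A p = {v.
     (\<forall>f g a b. smooth_fun A UNIV f \<longrightarrow> smooth_fun A UNIV g \<longrightarrow>
        v (\<lambda>q. a * f q + b * g q) = a * v f + b * v g \<and>
        v (\<lambda>q. f q * g q) = f p * v g + g p * v f) \<and>
     (\<forall>f. \<not> smooth_fun A UNIV f \<longrightarrow> v f = 0)}"

definition smooth_vfield ::
  "('a::{t2_space, second_countable_topology}, 'e::euclidean_space) chart set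
     \<Rightarrow> 'a set \<Rightarrow> 'a vfield \<Rightarrow> bool" where
  "smooth_vfield A U X \<longleftrightarrow>
     (\<forall>p\<in>U. X p \<in> tangent A p) \<and>
     (\<forall>f. smooth_fun A UNIV f \<longrightarrow> smooth_fun A U (\<lambda>p. X p f))"

definition lie_bracket :: "'a vfield \<Rightarrow> 'a vfield \<Rightarrow> 'a vfield" where
  "lie_bracket X Y = (\<lambda>p f. X p (\<lambda>q. Y q f) - Y p (\<lambda>q. X q f))"

definition covectors ::
  "('a::{t2_space, second_countable_topology}, 'e::euclidean_space) chart set
     \<Rightarrow> 'a \<Rightarrow> ('a tvec \<Rightarrow> real) set" where
  "covectors A p = {\<gamma>.
     (\<forall>u\<in>tangent A p. \<forall>v\<in>tangent A p. \<forall>a b. \<gamma> (a *\<^sub>R u + b *\<^sub>R v) = a * \<gamma> u + b * \<gamma> v) \<and>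
     (\<forall>v. v \<notin> tangent A p \<longrightarrow> \<gamma> v = 0)}"

definition one_form ::
  "('a::{t2_space, second_countable_topology}, 'e::euclidean_space) chart set
     \<Rightarrow> 'a set \<Rightarrow> 'a form1 \<Rightarrow> bool" where
  "one_form A U \<gamma> \<longleftrightarrow>
     (\<forall>p\<in>U. \<gamma> p \<in> covectors A p) \<and>
     (\<forall>X. smooth_vfield A UNIV X \<longrightarrow> smooth_fun A U (\<lambda>p. \<gamma> p (X p)))"

definition complex_one_form ::
  "('a::{t2_space, second_countable_topology}, 'e::euclidean_space) chart set
     \<Rightarrow> 'a set \<Rightarrow> 'a cform1 \<Rightarrow> bool" where
  "complex_one_form A U \<gamma> \<longleftrightarrow>
     one_form A U (\<lambda>p v. Re (\<gamma> p v)) \<and> one_form A U (\<lambda>p v. Im (\<gamma> p v))"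

text \<open>The value on \<open>u, v\<close> of the two-form \<open>d\<lambda>\<close> at \<open>p\<close>, which does not depend on the vector
  fields \<open>X, Y\<close> extending \<open>u, v\<close>.\<close>

definition ext_deriv ::
  "('a::{t2_space, second_countable_topology}, 'e::euclidean_space) chart set
     \<Rightarrow> 'a form1 \<Rightarrow> 'a \<Rightarrow> 'a tvec \<Rightarrow> 'a tvec \<Rightarrow> real" where
  "ext_deriv A lam p u v = (THE c. \<forall>X Y.
     smooth_vfield A UNIV X \<and> smooth_vfield A UNIV Y \<and> X p = u \<and> Y p = v \<longrightarrow>
     c = X p (\<lambda>q. lam q (Y q)) - Y p (\<lambda>q. lam q (X q)) - lam p (lie_bracket X Y p))"


section \<open>Contact triads\<close>

text \<open>The sum over permutations is, up to a positive factor depending only on \<open>n\<close>, the value of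
  \<open>\<lambda> \<and> (d\<lambda>)\<^sup>n\<close> on \<open>v 0, \<dots>, v (2 * n)\<close>.\<close>

definition contact_form ::
  "('a::{t2_space, second_countable_topology}, 'e::euclidean_space) chart set
     \<Rightarrow> nat \<Rightarrow> 'a form1 \<Rightarrow> bool" where
  "contact_form A n lam \<longleftrightarrow>
     one_form A UNIV lam \<and>
     (\<forall>p. \<exists>v :: nat \<Rightarrow> 'a tvec. (\<forall>i\<le>2 * n. v i \<in> tangent A p) \<and>
        (\<Sum>\<sigma> | \<sigma> permutes {..2 * n}.
           of_int (sign \<sigma>) * lam p (v (\<sigma> 0)) *
           (\<Prod>i<n. ext_deriv A lam p (v (\<sigma> (2 * i + 1))) (v (\<sigma> (2 * i + 2))))) \<noteq> 0)"

definition contact_dist ::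
  "('a::{t2_space, second_countable_topology}, 'e::euclidean_space) chart set
     \<Rightarrow> 'a form1 \<Rightarrow> 'a \<Rightarrow> 'a tvec set" where
  "contact_dist A lam p = {v \<in> tangent A p. lam p v = 0}"

definition reeb_field ::
  "('a::{t2_space, second_countable_topology}, 'e::euclidean_space) chart set
     \<Rightarrow> 'a form1 \<Rightarrow> 'a vfield \<Rightarrow> bool" where
  "reeb_field A lam R \<longleftrightarrow>
     smooth_vfield A UNIV R \<and>
     (\<forall>p. lam p (R p) = 1 \<and> (\<forall>v\<in>tangent A p. ext_deriv A lam p (R p) v = 0))"

definition contact_proj :: "'a form1 \<Rightarrow> 'a vfield \<Rightarrow> 'a \<Rightarrow> 'a tvec \<Rightarrow> 'a tvec" where
  "contact_proj lam R p v = v - lam p v *\<^sub>R R p"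

definition triad_metric ::
  "('a::{t2_space, second_countable_topology}, 'e::euclidean_space) chart set
     \<Rightarrow> 'a form1 \<Rightarrow> ('a \<Rightarrow> 'a tvec \<Rightarrow> 'a tvec) \<Rightarrow> 'a \<Rightarrow> 'a tvec \<Rightarrow> 'a tvec \<Rightarrow> real" where
  "triad_metric A lam J p u v = ext_deriv A lam p u (J p v) + lam p u * lam p v"

text \<open>\<open>J\<close> is the endomorphism of \<open>\<xi>\<close> already extended to the tangent bundle by \<open>J R = 0\<close>.\<close>

definition contact_complex_structure ::
  "('a::{t2_space, second_countable_topology}, 'e::euclidean_space) chart set
     \<Rightarrow> 'a form1 \<Rightarrow> 'a vfield \<Rightarrow> ('a \<Rightarrow> 'a tvec \<Rightarrow> 'a tvec) \<Rightarrow> bool" where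
  "contact_complex_structure A lam R J \<longleftrightarrow>
     (\<forall>p. \<forall>u\<in>tangent A p. \<forall>v\<in>tangent A p. \<forall>a b.
        J p (a *\<^sub>R u + b *\<^sub>R v) = a *\<^sub>R J p u + b *\<^sub>R J p v) \<and>
     (\<forall>X. smooth_vfield A UNIV X \<longrightarrow> smooth_vfield A UNIV (\<lambda>p. J p (X p))) \<and>
     (\<forall>p. J p (R p) = 0) \<and>
     (\<forall>p. \<forall>v\<in>contact_dist A lam p. J p v \<in> contact_dist A lam p \<and> J p (J p v) = - v) \<and>
     (\<forall>p. \<forall>u\<in>contact_dist A lam p. \<forall>v\<in>contact_dist A lam p.
        ext_deriv A lam p u (J p v) = ext_deriv A lam p v (J p u) \<and>
        ext_deriv A lam p (J p u) (J p (J p v)) = ext_deriv A lam p u (J p v)) \<and>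
     (\<forall>p. \<forall>v\<in>contact_dist A lam p. v \<noteq> 0 \<longrightarrow> ext_deriv A lam p v (J p v) > 0)"

definition contact_triad ::
  "('a::{t2_space, second_countable_topology}, 'e::euclidean_space) chart set
     \<Rightarrow> nat \<Rightarrow> 'a form1 \<Rightarrow> 'a vfield \<Rightarrow> ('a \<Rightarrow> 'a tvec \<Rightarrow> 'a tvec) \<Rightarrow> bool" where
  "contact_triad A n lam R J \<longleftrightarrow>
     smooth_atlas A \<and> DIM('e) = 2 * n + 1 \<and>
     contact_form A n lam \<and> reeb_field A lam R \<and> contact_complex_structure A lam R J"


section \<open>Connections\<close>

text \<open>\<open>nabla p v X\<close> is \<open>\<nabla>\<^sub>v X\<close>, for a tangent vector \<open>v\<close> at \<open>p\<close> and a smooth vector field \<open>X\<close>.\<close>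

type_synonym 'a connection = "'a \<Rightarrow> 'a tvec \<Rightarrow> 'a vfield \<Rightarrow> 'a tvec"

definition affine_connection ::
  "('a::{t2_space, second_countable_topology}, 'e::euclidean_space) chart set
     \<Rightarrow> 'a connection \<Rightarrow> bool" where
  "affine_connection A nabla \<longleftrightarrow>
     (\<forall>X p. smooth_vfield A UNIV X \<longrightarrow>
        (\<forall>v\<in>tangent A p. nabla p v X \<in> tangent A p) \<and>
        (\<forall>u\<in>tangent A p. \<forall>v\<in>tangent A p. \<forall>a b.
           nabla p (a *\<^sub>R u + b *\<^sub>R v) X = a *\<^sub>R nabla p u X + b *\<^sub>R nabla p v X)) \<and>
     (\<forall>X Y p. smooth_vfield A UNIV X \<longrightarrow> smooth_vfield A UNIV Y \<longrightarrow>
        (\<forall>v\<in>tangent A p. nabla p v (X + Y) = nabla p v X + nabla p v Y)) \<and>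
     (\<forall>f X p. smooth_fun A UNIV f \<longrightarrow> smooth_vfield A UNIV X \<longrightarrow>
        (\<forall>v\<in>tangent A p.
           nabla p v (\<lambda>q. f q *\<^sub>R X q) = v f *\<^sub>R X p + f p *\<^sub>R nabla p v X)) \<and>
     (\<forall>X Y. smooth_vfield A UNIV X \<longrightarrow> smooth_vfield A UNIV Y \<longrightarrow>
        smooth_vfield A UNIV (\<lambda>p. nabla p (X p) Y))"

definition torsion :: "'a connection \<Rightarrow> 'a vfield \<Rightarrow> 'a vfield \<Rightarrow> 'a vfield" where
  "torsion nabla X Y =
     (\<lambda>p. nabla p (X p) Y) - (\<lambda>p. nabla p (Y p) X) - lie_bracket X Y"

definition contact_section ::
  "('a::{t2_space, second_countable_topology}, 'e::euclidean_space) chart set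
     \<Rightarrow> 'a form1 \<Rightarrow> 'a vfield \<Rightarrow> bool" where
  "contact_section A lam Y \<longleftrightarrow>
     smooth_vfield A UNIV Y \<and> (\<forall>p. Y p \<in> contact_dist A lam p)"

definition metric_connection ::
  "('a::{t2_space, second_countable_topology}, 'e::euclidean_space) chart set \<Rightarrow> 'a form1
     \<Rightarrow> ('a \<Rightarrow> 'a tvec \<Rightarrow> 'a tvec) \<Rightarrow> 'a connection \<Rightarrow> bool" where
  "metric_connection A lam J nabla \<longleftrightarrow>
     (\<forall>X Y p. smooth_vfield A UNIV X \<longrightarrow> smooth_vfield A UNIV Y \<longrightarrow>
        (\<forall>v\<in>tangent A p.
           v (\<lambda>q. triad_metric A lam J q (X q) (Y q)) =
             triad_metric A lam J p (nabla p v X) (Y p) +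
             triad_metric A lam J p (X p) (nabla p v Y)))"

definition hermitian_contact_connection ::
  "('a::{t2_space, second_countable_topology}, 'e::euclidean_space) chart set \<Rightarrow> 'a form1
     \<Rightarrow> 'a vfield \<Rightarrow> ('a \<Rightarrow> 'a tvec \<Rightarrow> 'a tvec) \<Rightarrow> 'a connection \<Rightarrow> bool" where
  "hermitian_contact_connection A lam R J nabla \<longleftrightarrow>
     (let nabla_pi = (\<lambda>p v Y. contact_proj lam R p (nabla p v Y)) in
      (\<forall>X Y p. contact_section A lam X \<longrightarrow> contact_section A lam Y \<longrightarrow>
         (\<forall>v\<in>tangent A p.
            v (\<lambda>q. ext_deriv A lam q (X q) (Y q)) =
              ext_deriv A lam p (nabla_pi p v X) (Y p) +
              ext_deriv A lam p (X p) (nabla_pi p v Y))) \<and>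
      (\<forall>Y p. contact_section A lam Y \<longrightarrow>
         (\<forall>v\<in>tangent A p. nabla_pi p v (\<lambda>q. J q (Y q)) = J p (nabla_pi p v Y))))"

text \<open>Axioms (1) to (5), in this order. The torsion is a tensor, so that conditions on it are
  stated for vector fields and sections of \<open>\<xi>\<close>.\<close>

definition triad_connection_axioms ::
  "('a::{t2_space, second_countable_topology}, 'e::euclidean_space) chart set \<Rightarrow> 'a form1
     \<Rightarrow> 'a vfield \<Rightarrow> ('a \<Rightarrow> 'a tvec \<Rightarrow> 'a tvec) \<Rightarrow> 'a connection \<Rightarrow> bool" where
  "triad_connection_axioms A lam R J nabla \<longleftrightarrow>
     metric_connection A lam J nabla \<and>
     (\<forall>Y. smooth_vfield A UNIV Y \<longrightarrow> torsion nabla R Y = 0) \<and>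
     ((\<forall>p. nabla p (R p) R = 0) \<and>
      (\<forall>p. \<forall>v\<in>contact_dist A lam p. nabla p v R \<in> contact_dist A lam p)) \<and>
     hermitian_contact_connection A lam R J nabla \<and>
     (\<forall>Y p. contact_section A lam Y \<longrightarrow>
        contact_proj lam R p (torsion nabla (\<lambda>q. J q (Y q)) Y p) = 0)"


section \<open>Almost contact frames and types of one-forms\<close>

definition almost_contact_frame ::
  "('a::{t2_space, second_countable_topology}, 'e::euclidean_space) chart set
     \<Rightarrow> nat \<Rightarrow> 'a form1 \<Rightarrow> 'a vfield \<Rightarrow> ('a \<Rightarrow> 'a tvec \<Rightarrow> 'a tvec)
     \<Rightarrow> 'a set \<Rightarrow> (nat \<Rightarrow> 'a vfield) \<Rightarrow> (nat \<Rightarrow> 'a vfield) \<Rightarrow> bool" where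
  "almost_contact_frame A n lam R J U E F \<longleftrightarrow>
     open U \<and>
     (\<forall>i\<in>{1..n}. smooth_vfield A U (E i) \<and> smooth_vfield A U (F i)) \<and>
     (\<forall>p\<in>U.
        (\<forall>i\<in>{1..n}. E i p \<in> contact_dist A lam p \<and> F i p = J p (E i p)) \<and>
        span ((\<lambda>i. E i p) ` {1..n} \<union> (\<lambda>i. F i p) ` {1..n} \<union> {R p}) = tangent A p \<and>
        (let g = triad_metric A lam J p; \<omega> = ext_deriv A lam p in
         (\<forall>i\<in>{1..n}. \<forall>j\<in>{1..n}.
            g (E i p) (E j p) = of_bool (i = j) \<and>
            g (F i p) (F j p) = of_bool (i = j) \<and>
            g (E i p) (F j p) = 0 \<and>
            \<omega> (E i p) (E j p) = 0 \<and> \<omega> (F i p) (F j p) = 0 \<and>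
            \<omega> (E i p) (F j p) = of_bool (i = j)) \<and>
         (\<forall>i\<in>{1..n}. g (E i p) (R p) = 0 \<and> g (F i p) (R p) = 0) \<and>
         g (R p) (R p) = 1))"

text \<open>\<open>e, f\<close>, together with \<open>\<lambda>\<close>, form the coframe dual to \<open>E, F, R\<close>; that \<open>\<lambda>\<close> is dual to \<open>R\<close>
  is part of the definitions of \<open>R\<close> and of the frame.\<close>

definition dual_coframe ::
  "('a::{t2_space, second_countable_topology}, 'e::euclidean_space) chart set
     \<Rightarrow> nat \<Rightarrow> 'a vfield \<Rightarrow> 'a set \<Rightarrow> (nat \<Rightarrow> 'a vfield) \<Rightarrow> (nat \<Rightarrow> 'a vfield)
     \<Rightarrow> (nat \<Rightarrow> 'a form1) \<Rightarrow> (nat \<Rightarrow> 'a form1) \<Rightarrow> bool" where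
  "dual_coframe A n R U E F e f \<longleftrightarrow>
     (\<forall>i\<in>{1..n}. one_form A U (e i) \<and> one_form A U (f i)) \<and>
     (\<forall>p\<in>U. \<forall>i\<in>{1..n}.
        (\<forall>j\<in>{1..n}.
           e i p (E j p) = of_bool (i = j) \<and> e i p (F j p) = 0 \<and>
           f i p (E j p) = 0 \<and> f i p (F j p) = of_bool (i = j)) \<and>
        e i p (R p) = 0 \<and> f i p (R p) = 0)"

text \<open>A complexified tangent vector is a complex-valued derivation of the real smooth functions.\<close>

definition eta :: "(nat \<Rightarrow> 'a vfield) \<Rightarrow> (nat \<Rightarrow> 'a vfield) \<Rightarrow> nat \<Rightarrow> 'a \<Rightarrow> 'a ctvec" where
  "eta E F i p = (\<lambda>h. (complex_of_real (E i p h) - \<i> * complex_of_real (F i p h)) / sqrt 2)"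

definition theta :: "(nat \<Rightarrow> 'a form1) \<Rightarrow> (nat \<Rightarrow> 'a form1) \<Rightarrow> nat \<Rightarrow> 'a cform1" where
  "theta e f i p = (\<lambda>v. (complex_of_real (e i p v) + \<i> * complex_of_real (f i p v)) / sqrt 2)"

definition connection_forms ::
  "('a::{t2_space, second_countable_topology}, 'e::euclidean_space) chart set
     \<Rightarrow> nat \<Rightarrow> 'a vfield \<Rightarrow> 'a connection \<Rightarrow> 'a set
     \<Rightarrow> (nat \<Rightarrow> 'a vfield) \<Rightarrow> (nat \<Rightarrow> 'a vfield) \<Rightarrow> (nat \<Rightarrow> 'a cform1) \<Rightarrow> bool" where
  "connection_forms A n R nabla U E F \<alpha> \<longleftrightarrow>
     (\<forall>k\<in>{1..n}. complex_one_form A U (\<alpha> k)) \<and>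
     (\<forall>p\<in>U. \<forall>v\<in>tangent A p. \<forall>h.
        complex_of_real (nabla p v R h) =
          (\<Sum>k=1..n. \<alpha> k p v * eta E F k p h) +
          (\<Sum>k=1..n. cnj (\<alpha> k p v) * cnj (eta E F k p h)))"

definition perp_part :: "'a form1 \<Rightarrow> 'a vfield \<Rightarrow> 'a cform1 \<Rightarrow> 'a cform1" where
  "perp_part lam R \<gamma> = (\<lambda>p v. \<gamma> p (R p) * complex_of_real (lam p v))"

definition pi_part :: "'a form1 \<Rightarrow> 'a vfield \<Rightarrow> 'a cform1 \<Rightarrow> 'a cform1" where
  "pi_part lam R \<gamma> = \<gamma> - perp_part lam R \<gamma>"

definition forms10 ::
  "nat \<Rightarrow> (nat \<Rightarrow> 'a form1) \<Rightarrow> (nat \<Rightarrow> 'a form1) \<Rightarrow> 'a \<Rightarrow> ('a tvec \<Rightarrow> complex) set" where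
  "forms10 n e f p = {(\<lambda>v. \<Sum>i=1..n. c i * theta e f i p v) | c. True}"

definition forms01 ::
  "nat \<Rightarrow> (nat \<Rightarrow> 'a form1) \<Rightarrow> (nat \<Rightarrow> 'a form1) \<Rightarrow> 'a \<Rightarrow> ('a tvec \<Rightarrow> complex) set" where
  "forms01 n e f p = {(\<lambda>v. \<Sum>i=1..n. c i * cnj (theta e f i p v)) | c. True}"

text \<open>The \<open>(1,0)\<close>-component of a complex covector \<open>\<gamma>\<close> at \<open>p\<close> with \<open>\<gamma> (R p) = 0\<close>, that is, the
  projection to the first summand of the direct sum of \<open>forms10\<close> and \<open>forms01\<close>.\<close>

definition part10 ::
  "nat \<Rightarrow> (nat \<Rightarrow> 'a form1) \<Rightarrow> (nat \<Rightarrow> 'a form1) \<Rightarrow> 'a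
     \<Rightarrow> ('a tvec \<Rightarrow> complex) \<Rightarrow> ('a tvec \<Rightarrow> complex)" where
  "part10 n e f p \<gamma> = (THE \<beta>. \<beta> \<in> forms10 n e f p \<and> \<gamma> - \<beta> \<in> forms01 n e f p)"

end

theory Submission
  imports Defs
begin

text \<open>The proof is linear algebra in a single tangent space \<open>T\<^sub>pM\<close>. Pairing the defining
  equation of the \<open>\<alpha>\<^sup>0\<^sub>k\<close> with the coframe shows that \<open>\<alpha>\<^sup>0\<^sub>k(v) = \<theta>\<^sup>k(\<nabla>\<^sub>vR)\<close>, so that
  \<open>\<alpha>\<^sup>0\<^sub>k(R) = 0\<close> is the axiom \<open>\<nabla>\<^sub>RR = 0\<close>, and therefore \<open>\<alpha>\<^sup>0\<^sub>k\<close> is its own \<open>\<pi>\<close>-part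
  (lemma \<open>theta_nabla_reeb\<close>).

  The covectors \<open>\<theta>\<^sup>k\<close> are complex linear, \<open>\<theta>\<^sup>k \<circ> J = \<i> \<theta>\<^sup>k\<close> (lemma \<open>theta_J\<close>). Applied to
  the vector \<open>\<nabla>\<^sub>J\<^sub>vR + J\<nabla>\<^sub>vR\<close> they give \<open>\<alpha>\<^sup>0\<^sub>k(Jv) + \<i> \<alpha>\<^sup>0\<^sub>k(v)\<close>. That vector lies in \<open>\<xi>\<close>, where
  the \<open>\<theta>\<^sup>k\<close> jointly separate points (lemma \<open>eq_0_if_theta_eq_0\<close>), so it vanishes for all \<open>v \<in> \<xi>\<close>
  exactly if every \<open>\<alpha>\<^sup>0\<^sub>k\<close> is complex antilinear on \<open>\<xi>\<close>. A covector that kills \<open>R\<close> is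
  antilinear on \<open>\<xi>\<close> if and only if it has type \<open>(0,1)\<close> (lemma \<open>forms01_iff_antilinear\<close>), and
  if and only if its \<open>(1,0)\<close>-part vanishes (lemma \<open>part10_eq_0_iff\<close>).\<close>


section \<open>Real linear maps on a subspace\<close>

text \<open>Tangent spaces are subspaces of a function type, and covectors are \<open>0\<close> outside them, so
  that linearity is only available relative to a subset.\<close>

definition linear_within :: "'v::real_vector set \<Rightarrow> ('v \<Rightarrow> 'w::real_vector) \<Rightarrow> bool" where
  "linear_within T \<phi> \<longleftrightarrow>
     (\<forall>u\<in>T. \<forall>v\<in>T. \<forall>a b. \<phi> (a *\<^sub>R u + b *\<^sub>R v) = a *\<^sub>R \<phi> u + b *\<^sub>R \<phi> v)"

lemma linear_withinD:
  "linear_within T \<phi> \<Longrightarrow> u \<in> T \<Longrightarrow> v \<in> T \<Longrightarrow> \<phi> (a *\<^sub>R u + b *\<^sub>R v) = a *\<^sub>R \<phi> u + b *\<^sub>R \<phi> v"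
  by (simp add: linear_within_def)

lemma linear_within_add:
  "linear_within T \<phi> \<Longrightarrow> linear_within T \<psi> \<Longrightarrow> linear_within T (\<lambda>v. \<phi> v + \<psi> v)"
  by (simp add: linear_within_def scaleR_add_right)

lemma linear_within_sum:
  "(\<And>i. i \<in> I \<Longrightarrow> linear_within T (\<phi> i)) \<Longrightarrow> linear_within T (\<lambda>v. \<Sum>i\<in>I. \<phi> i v)"
  by (simp add: linear_within_def sum.distrib scaleR_sum_right)

lemma linear_within_compose:
  "linear \<psi> \<Longrightarrow> linear_within T \<phi> \<Longrightarrow> linear_within T (\<lambda>v. \<psi> (\<phi> v))"
  by (simp add: linear_within_def linear_add linear_scale)

lemma linear_within_cmult:
  "linear_within T \<phi> \<Longrightarrow> linear_within T (\<lambda>v. (c::complex) * \<phi> v)"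
  by (rule linear_within_compose[where \<psi> = "(*) c"]) (auto intro: linearI simp: algebra_simps)

lemma linear_within_cnj: "linear_within T \<phi> \<Longrightarrow> linear_within T (\<lambda>v. cnj (\<phi> v))"
  by (rule linear_within_compose) (auto intro: linearI)

lemma linear_within_eq_on_span:
  assumes "linear_within (span B) \<phi>" "linear_within (span B) \<psi>"
    and "\<And>x. x \<in> B \<Longrightarrow> \<phi> x = \<psi> x" and v: "v \<in> span B"
  shows "\<phi> v = \<psi> v"
proof -
  have "0 \<in> {v \<in> span B. \<phi> v = \<psi> v}"
    using linear_withinD[OF assms(1) span_zero span_zero, of 0 0]
      linear_withinD[OF assms(2) span_zero span_zero, of 0 0]
    by (simp add: span_zero)
  moreover have "x + y \<in> {v \<in> span B. \<phi> v = \<psi> v}"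
    if "x \<in> {v \<in> span B. \<phi> v = \<psi> v}" "y \<in> {v \<in> span B. \<phi> v = \<psi> v}" for x y
    using that linear_withinD[OF assms(1), of x y 1 1] linear_withinD[OF assms(2), of x y 1 1]
    by (simp add: span_add)
  moreover have "c *\<^sub>R x \<in> {v \<in> span B. \<phi> v = \<psi> v}"
    if "x \<in> {v \<in> span B. \<phi> v = \<psi> v}" for c x
    using that linear_withinD[OF assms(1), of x x c 0] linear_withinD[OF assms(2), of x x c 0]
    by (simp add: span_scale)
  ultimately have "subspace {v \<in> span B. \<phi> v = \<psi> v}"
    by (auto intro!: subspaceI)
  then show ?thesis
    using span_induct[OF v, of "\<lambda>v. v \<in> {v \<in> span B. \<phi> v = \<psi> v}"] assms(3)
    by (simp add: span_base)
qed

lemma linear_within_apply_sum: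
  assumes "linear_within T \<phi>" "subspace T" "finite I" "\<And>i. i \<in> I \<Longrightarrow> x i \<in> T"
  shows "\<phi> (\<Sum>i\<in>I. c i *\<^sub>R x i) = (\<Sum>i\<in>I. c i *\<^sub>R \<phi> (x i))"
  using assms(3,4)
proof (induction I rule: finite_induct)
  case empty
  show ?case
    using linear_withinD[OF assms(1), of 0 0 0 0] subspace_0[OF assms(2)] by simp
next
  case (insert j I)
  have "(\<Sum>i\<in>I. c i *\<^sub>R x i) \<in> T"
    using insert.prems by (intro subspace_sum[OF assms(2)] subspace_scale[OF assms(2)]) auto
  then show ?case
    using insert linear_withinD[OF assms(1), of "x j" "\<Sum>i\<in>I. c i *\<^sub>R x i" "c j" 1] by simp
qed

lemma sum_fun_apply: "(\<Sum>i\<in>I. \<phi> i) x = (\<Sum>i\<in>I. \<phi> i x)"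
  by (induction I rule: infinite_finite_induct) auto


section \<open>The tangent space at a point of an almost contact frame\<close>

text \<open>The data at one point \<open>p\<close>: \<open>T\<close> stands for the tangent space, \<open>l\<close>, \<open>r\<close> and \<open>I\<close> for the
  values of \<open>\<lambda>\<close>, of the Reeb field and of \<open>J\<close>. The fields \<open>E\<close>, \<open>F\<close>, \<open>e\<close>, \<open>f\<close> are kept as
  functions of the point, because \<open>theta\<close>, \<open>forms10\<close> and \<open>part10\<close> take them in that form.\<close>

locale almost_contact_frame_at =
  fixes T :: "'a tvec set" and l :: "'a tvec \<Rightarrow> real" and r :: "'a tvec"
    and I :: "'a tvec \<Rightarrow> 'a tvec" and n :: nat and p :: 'a
    and E F :: "nat \<Rightarrow> 'a vfield" and e f :: "nat \<Rightarrow> 'a form1"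
  assumes span_frame: "span ((\<lambda>i. E i p) ` {1..n} \<union> (\<lambda>i. F i p) ` {1..n} \<union> {r}) = T"
    and l_linear: "linear_within T l"
    and I_linear: "linear_within T I"
    and e_linear: "i \<in> {1..n} \<Longrightarrow> linear_within T (e i p)"
    and f_linear: "i \<in> {1..n} \<Longrightarrow> linear_within T (f i p)"
    and e_outside: "i \<in> {1..n} \<Longrightarrow> v \<notin> T \<Longrightarrow> e i p v = 0"
    and f_outside: "i \<in> {1..n} \<Longrightarrow> v \<notin> T \<Longrightarrow> f i p v = 0"
    and I_frame: "i \<in> {1..n} \<Longrightarrow> I (E i p) = F i p" "i \<in> {1..n} \<Longrightarrow> I (F i p) = - E i p"
      "I r = 0"
    and l_frame: "i \<in> {1..n} \<Longrightarrow> l (E i p) = 0" "i \<in> {1..n} \<Longrightarrow> l (F i p) = 0" "l r = 1"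
    and dual: "i \<in> {1..n} \<Longrightarrow> j \<in> {1..n} \<Longrightarrow> e i p (E j p) = of_bool (i = j)"
      "i \<in> {1..n} \<Longrightarrow> j \<in> {1..n} \<Longrightarrow> e i p (F j p) = 0"
      "i \<in> {1..n} \<Longrightarrow> j \<in> {1..n} \<Longrightarrow> f i p (E j p) = 0"
      "i \<in> {1..n} \<Longrightarrow> j \<in> {1..n} \<Longrightarrow> f i p (F j p) = of_bool (i = j)"
      "i \<in> {1..n} \<Longrightarrow> e i p r = 0" "i \<in> {1..n} \<Longrightarrow> f i p r = 0"
begin

lemma subspace_T: "subspace T"
  using span_frame subspace_span by metis

lemma frame_in_T: "i \<in> {1..n} \<Longrightarrow> E i p \<in> T" "i \<in> {1..n} \<Longrightarrow> F i p \<in> T" "r \<in> T"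
  using span_frame by (auto intro: span_base)

lemma eq_if_eq_on_frame:
  assumes "linear_within T \<phi>" "linear_within T \<psi>"
    and "\<And>i. i \<in> {1..n} \<Longrightarrow> \<phi> (E i p) = \<psi> (E i p)"
    and "\<And>i. i \<in> {1..n} \<Longrightarrow> \<phi> (F i p) = \<psi> (F i p)"
    and "\<phi> r = \<psi> r" and "v \<in> T"
  shows "\<phi> v = \<psi> v"
  using linear_within_eq_on_span
    [of "(\<lambda>i. E i p) ` {1..n} \<union> (\<lambda>i. F i p) ` {1..n} \<union> {r}" \<phi> \<psi> v]
  unfolding span_frame using assms by blast

lemma I_in_T: "v \<in> T \<Longrightarrow> I v \<in> T"
proof -
  assume v: "v \<in> T"
  have "subspace {v \<in> T. I v \<in> T}"
  proof (rule subspaceI)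
    show "0 \<in> {v \<in> T. I v \<in> T}"
      using linear_withinD[OF I_linear, of 0 0 0 0] subspace_0[OF subspace_T] by simp
    show "x + y \<in> {v \<in> T. I v \<in> T}" if "x \<in> {v \<in> T. I v \<in> T}" "y \<in> {v \<in> T. I v \<in> T}" for x y
      using that linear_withinD[OF I_linear, of x y 1 1] by (simp add: subspace_add[OF subspace_T])
    show "c *\<^sub>R x \<in> {v \<in> T. I v \<in> T}" if "x \<in> {v \<in> T. I v \<in> T}" for c x
      using that linear_withinD[OF I_linear, of x x c 0]
      by (simp add: subspace_scale[OF subspace_T])
  qed
  then have "span ((\<lambda>i. E i p) ` {1..n} \<union> (\<lambda>i. F i p) ` {1..n} \<union> {r}) \<subseteq> {v \<in> T. I v \<in> T}"
    using frame_in_T I_frame subspace_neg[OF subspace_T] subspace_0[OF subspace_T]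
    by (intro span_minimal) auto
  then show "I v \<in> T"
    using v span_frame by auto
qed

lemma linear_within_I:
  assumes "linear_within T \<phi>"
  shows "linear_within T (\<lambda>v. \<phi> (I v))"
  using assms I_in_T linear_withinD[OF I_linear] by (simp add: linear_within_def)

lemma frame_expansion:
  assumes "v \<in> T"
  shows "v = (\<Sum>i=1..n. e i p v *\<^sub>R E i p) + (\<Sum>i=1..n. f i p v *\<^sub>R F i p) + l v *\<^sub>R r"
    (is "_ = ?x v + ?y v + ?z v")
proof (rule eq_if_eq_on_frame[of "\<lambda>v. v" "\<lambda>v. ?x v + ?y v + ?z v", OF _ _ _ _ _ assms])
  show "linear_within T (\<lambda>v. v)"
    by (simp add: linear_within_def)
  have "linear (\<lambda>a. a *\<^sub>R u)" for u :: "'a tvec"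
    by (rule linearI) (simp_all add: scaleR_add_left)
  note scale = linear_within_compose[OF this]
  show "linear_within T (\<lambda>v. ?x v + ?y v + ?z v)"
    by (intro linear_within_add linear_within_sum scale e_linear f_linear l_linear)
  fix j
  assume j: "j \<in> {1..n}"
  have "?x (E j p) = (\<Sum>i=1..n. if i = j then E j p else 0)"
    using j by (intro sum.cong) (auto simp: dual)
  also have "\<dots> = E j p"
    using j by simp
  finally have x: "?x (E j p) = E j p" .
  have y: "?y (E j p) = 0"
    using j by (intro sum.neutral) (auto simp: dual)
  show "E j p = ?x (E j p) + ?y (E j p) + ?z (E j p)"
    by (simp only: x y l_frame(1,2)[OF j] scaleR_zero_left add_0_right add_0_left)
  have "?y (F j p) = (\<Sum>i=1..n. if i = j then F j p else 0)"
    using j by (intro sum.cong) (auto simp: dual)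
  also have "\<dots> = F j p"
    using j by simp
  finally have y: "?y (F j p) = F j p" .
  have x: "?x (F j p) = 0"
    using j by (intro sum.neutral) (auto simp: dual)
  show "F j p = ?x (F j p) + ?y (F j p) + ?z (F j p)"
    by (simp only: x y l_frame(1,2)[OF j] scaleR_zero_left add_0_right add_0_left)
next
  have x: "?x r = 0"
    by (intro sum.neutral ballI) (simp only: dual scaleR_zero_left)
  have y: "?y r = 0"
    by (intro sum.neutral ballI) (simp only: dual scaleR_zero_left)
  show "r = ?x r + ?y r + ?z r"
    by (simp only: x y l_frame(3) scaleR_one add_0_left)
qed


section \<open>Covectors of type (1,0) and (0,1)\<close>

lemma theta_linear: "i \<in> {1..n} \<Longrightarrow> linear_within T (theta e f i p)"
  by (simp add: theta_def linear_within_def linear_withinD[OF e_linear] linear_withinD[OF f_linear]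
      scaleR_conv_of_real field_simps)

lemma theta_outside: "i \<in> {1..n} \<Longrightarrow> v \<notin> T \<Longrightarrow> theta e f i p v = 0"
  by (simp add: theta_def e_outside f_outside)

lemma theta_frame:
  assumes "i \<in> {1..n}" "j \<in> {1..n}"
  shows "theta e f i p (E j p) = of_bool (i = j) / sqrt 2"
    and "theta e f i p (F j p) = \<i> * of_bool (i = j) / sqrt 2"
    and "theta e f i p r = 0"
  using assms by (auto simp: theta_def dual)

text \<open>Since \<open>J E\<^sub>k = F\<^sub>k\<close>, \<open>J F\<^sub>k = - E\<^sub>k\<close> and \<open>J R = 0\<close>, both sides agree on the frame.\<close>

lemma theta_J:
  assumes i: "i \<in> {1..n}" and "v \<in> T"
  shows "theta e f i p (I v) = \<i> * theta e f i p v"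
proof (rule eq_if_eq_on_frame[OF _ _ _ _ _ \<open>v \<in> T\<close>])
  note minus = linear_withinD[OF theta_linear[OF i], of _ _ "-1" 0]
  show "linear_within T (\<lambda>v. theta e f i p (I v))"
    by (intro linear_within_I theta_linear i)
  show "linear_within T (\<lambda>v. \<i> * theta e f i p v)"
    by (intro linear_within_cmult theta_linear i)
  show "theta e f i p (I (E j p)) = \<i> * theta e f i p (E j p)" if "j \<in> {1..n}" for j
    using that i by (simp add: I_frame theta_frame)
  show "theta e f i p (I (F j p)) = \<i> * theta e f i p (F j p)" if "j \<in> {1..n}" for j
    using that i minus[of "E j p" "E j p"] by (simp add: I_frame theta_frame frame_in_T)
  show "theta e f i p (I r) = \<i> * theta e f i p r"
    using i linear_withinD[OF theta_linear[OF i], of r r 0 0]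
    by (simp add: I_frame theta_frame frame_in_T)
qed

text \<open>The real and imaginary parts of the \<open>\<theta>\<^sup>k(v)\<close> are the \<open>E\<close>- and \<open>F\<close>-coordinates of \<open>v\<close>, up to
  the factor \<open>1 / \<surd>2\<close>, and \<open>\<lambda>(v)\<close> is its \<open>R\<close>-coordinate.\<close>

lemma eq_0_if_theta_eq_0:
  assumes "v \<in> T" "l v = 0" "\<And>i. i \<in> {1..n} \<Longrightarrow> theta e f i p v = 0"
  shows "v = 0"
proof -
  have "e i p v = 0 \<and> f i p v = 0" if "i \<in> {1..n}" for i
    using assms(3)[OF that] by (simp add: theta_def complex_eq_iff)
  then show ?thesis
    using frame_expansion[OF assms(1)] assms(2) by simp
qed

lemma theta_combination:
  assumes k: "k \<in> {1..n}"
  shows "theta e f k p ((\<Sum>i=1..n. a i *\<^sub>R E i p) + (\<Sum>i=1..n. b i *\<^sub>R F i p)) =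
    (a k + \<i> * b k) / sqrt 2"
proof -
  let ?u = "\<Sum>i=1..n. a i *\<^sub>R E i p" and ?v = "\<Sum>i=1..n. b i *\<^sub>R F i p"
  have T: "?u \<in> T" "?v \<in> T"
    by (intro subspace_sum[OF subspace_T] subspace_scale[OF subspace_T] frame_in_T; simp)+
  have "theta e f k p ?u = (\<Sum>i=1..n. a i *\<^sub>R theta e f k p (E i p))"
    by (rule linear_within_apply_sum[OF theta_linear[OF k] subspace_T]) (auto intro: frame_in_T)
  also have "\<dots> = (\<Sum>i=1..n. if i = k then complex_of_real (a k) / sqrt 2 else 0)"
    using k by (intro sum.cong) (auto simp: theta_frame scaleR_conv_of_real)
  finally have u: "theta e f k p ?u = a k / sqrt 2"
    using k by simp
  have "theta e f k p ?v = (\<Sum>i=1..n. b i *\<^sub>R theta e f k p (F i p))"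
    by (rule linear_within_apply_sum[OF theta_linear[OF k] subspace_T]) (auto intro: frame_in_T)
  also have "\<dots> = (\<Sum>i=1..n. if i = k then \<i> * b k / sqrt 2 else 0)"
    using k by (intro sum.cong) (auto simp: theta_frame scaleR_conv_of_real)
  finally have v: "theta e f k p ?v = \<i> * b k / sqrt 2"
    using k by simp
  show ?thesis
    using linear_withinD[OF theta_linear[OF k] T, of 1 1] u v by (simp add: add_divide_distrib)
qed

lemma forms10I: "(\<lambda>v. \<Sum>i=1..n. c i * theta e f i p v) \<in> forms10 n e f p"
  by (auto simp: forms10_def intro: exI[of _ c])

lemma forms01I: "(\<lambda>v. \<Sum>i=1..n. c i * cnj (theta e f i p v)) \<in> forms01 n e f p"
  by (auto simp: forms01_def intro: exI[of _ c])

lemma forms10_J: "\<beta> \<in> forms10 n e f p \<Longrightarrow> v \<in> T \<Longrightarrow> \<beta> (I v) = \<i> * \<beta> v"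
  by (auto simp: forms10_def theta_J sum_distrib_left algebra_simps)

lemma forms01_J: "\<beta> \<in> forms01 n e f p \<Longrightarrow> v \<in> T \<Longrightarrow> \<beta> (I v) = - \<i> * \<beta> v"
  by (auto simp: forms01_def theta_J sum_distrib_left sum_negf algebra_simps)

text \<open>Uniqueness of the type decomposition: a covector of both types is multiplied by \<open>\<i>\<close> and by
  \<open>- \<i>\<close> under \<open>J\<close>.\<close>

lemma forms10_inter_forms01:
  assumes "\<beta> \<in> forms10 n e f p" "\<beta> \<in> forms01 n e f p"
  shows "\<beta> = 0"
proof
  fix v
  show "\<beta> v = 0 v"
  proof (cases "v \<in> T")
    case True
    then show ?thesis
      using forms10_J[OF assms(1)] forms01_J[OF assms(2)] by (simp add: complex_eq_iff)
  next
    case False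
    then show ?thesis
      using assms(1) by (auto simp: forms10_def theta_outside)
  qed
qed

lemma forms10_diff:
  assumes "\<beta> \<in> forms10 n e f p" "\<gamma> \<in> forms10 n e f p"
  shows "\<beta> - \<gamma> \<in> forms10 n e f p"
proof -
  obtain b c where "\<beta> = (\<lambda>v. \<Sum>i=1..n. b i * theta e f i p v)"
    "\<gamma> = (\<lambda>v. \<Sum>i=1..n. c i * theta e f i p v)"
    using assms by (auto simp: forms10_def)
  then have "\<beta> - \<gamma> = (\<lambda>v. \<Sum>i=1..n. (b i - c i) * theta e f i p v)"
    by (auto simp: sum_subtractf left_diff_distrib)
  then show ?thesis
    by (simp only: forms10I)
qed

lemma forms01_diff:
  assumes "\<beta> \<in> forms01 n e f p" "\<gamma> \<in> forms01 n e f p"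
  shows "\<beta> - \<gamma> \<in> forms01 n e f p"
proof -
  obtain b c where "\<beta> = (\<lambda>v. \<Sum>i=1..n. b i * cnj (theta e f i p v))"
    "\<gamma> = (\<lambda>v. \<Sum>i=1..n. c i * cnj (theta e f i p v))"
    using assms by (auto simp: forms01_def)
  then have "\<beta> - \<gamma> = (\<lambda>v. \<Sum>i=1..n. (b i - c i) * cnj (theta e f i p v))"
    by (auto simp: sum_subtractf left_diff_distrib)
  then show ?thesis
    by (simp only: forms01I)
qed

text \<open>Existence of the type decomposition. The coefficients are \<open>\<gamma>(\<eta>\<^sub>i)\<close> and \<open>\<gamma>\<close> of the conjugate
  of \<open>\<eta>\<^sub>i\<close>, for the complex linear extension of \<open>\<gamma>\<close>.\<close>

lemma type_decomposition:
  assumes "linear_within T \<gamma>" "\<And>v. v \<notin> T \<Longrightarrow> \<gamma> v = 0" "\<gamma> r = 0"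
  shows "\<gamma> = (\<lambda>v. (\<Sum>i=1..n. (\<gamma> (E i p) - \<i> * \<gamma> (F i p)) / sqrt 2 * theta e f i p v) +
    (\<Sum>i=1..n. (\<gamma> (E i p) + \<i> * \<gamma> (F i p)) / sqrt 2 * cnj (theta e f i p v)))"
    (is "_ = (\<lambda>v. ?b v + ?c v)")
proof
  fix v
  show "\<gamma> v = ?b v + ?c v"
  proof (cases "v \<in> T")
    case True
    have 2: "complex_of_real (sqrt 2) * complex_of_real (sqrt 2) = 2"
      by (simp flip: of_real_mult)
    show ?thesis
    proof (rule eq_if_eq_on_frame[OF assms(1) _ _ _ _ True])
      show "linear_within T (\<lambda>v. ?b v + ?c v)"
        by (intro linear_within_add linear_within_sum linear_within_cmult linear_within_cnj
            theta_linear)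
      show "\<gamma> (E j p) = ?b (E j p) + ?c (E j p)" if j: "j \<in> {1..n}" for j
      proof -
        have "?b (E j p) = (\<Sum>i=1..n. if i = j then (\<gamma> (E j p) - \<i> * \<gamma> (F j p)) / 2 else 0)"
          using j 2 by (intro sum.cong) (auto simp: theta_frame algebra_simps add_divide_distrib diff_divide_distrib)
        also have "\<dots> = (\<gamma> (E j p) - \<i> * \<gamma> (F j p)) / 2"
          using j by simp
        finally have b: "?b (E j p) = (\<gamma> (E j p) - \<i> * \<gamma> (F j p)) / 2" .
        have "?c (E j p) = (\<Sum>i=1..n. if i = j then (\<gamma> (E j p) + \<i> * \<gamma> (F j p)) / 2 else 0)"
          using j 2 by (intro sum.cong) (auto simp: theta_frame algebra_simps add_divide_distrib diff_divide_distrib)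
        also have "\<dots> = (\<gamma> (E j p) + \<i> * \<gamma> (F j p)) / 2"
          using j by simp
        finally have c: "?c (E j p) = (\<gamma> (E j p) + \<i> * \<gamma> (F j p)) / 2" .
        show ?thesis
          unfolding b c by (simp add: complex_eq_iff field_simps)
      qed
      show "\<gamma> (F j p) = ?b (F j p) + ?c (F j p)" if j: "j \<in> {1..n}" for j
      proof -
        have "?b (F j p) = (\<Sum>i=1..n. if i = j then (\<i> * \<gamma> (E j p) + \<gamma> (F j p)) / 2 else 0)"
          using j 2 by (intro sum.cong) (auto simp: theta_frame algebra_simps add_divide_distrib diff_divide_distrib)
        also have "\<dots> = (\<i> * \<gamma> (E j p) + \<gamma> (F j p)) / 2"
          using j by simp
        finally have b: "?b (F j p) = (\<i> * \<gamma> (E j p) + \<gamma> (F j p)) / 2" .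
        have "?c (F j p) = (\<Sum>i=1..n. if i = j then (\<gamma> (F j p) - \<i> * \<gamma> (E j p)) / 2 else 0)"
          using j 2 by (intro sum.cong) (auto simp: theta_frame algebra_simps add_divide_distrib diff_divide_distrib)
        also have "\<dots> = (\<gamma> (F j p) - \<i> * \<gamma> (E j p)) / 2"
          using j by simp
        finally have c: "?c (F j p) = (\<gamma> (F j p) - \<i> * \<gamma> (E j p)) / 2" .
        show ?thesis
          unfolding b c by (simp add: complex_eq_iff field_simps)
      qed
      show "\<gamma> r = ?b r + ?c r"
        using assms(3) by (simp add: theta_frame)
    qed
  next
    case False
    then show ?thesis
      by (simp add: assms(2) theta_outside)
  qed
qed

lemma part10_eqI:
  assumes "\<beta> \<in> forms10 n e f p" "\<gamma> - \<beta> \<in> forms01 n e f p"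
  shows "part10 n e f p \<gamma> = \<beta>"
  unfolding part10_def
proof (rule the_equality)
  fix \<beta>'
  assume \<beta>': "\<beta>' \<in> forms10 n e f p \<and> \<gamma> - \<beta>' \<in> forms01 n e f p"
  have "\<beta>' - \<beta> = (\<gamma> - \<beta>) - (\<gamma> - \<beta>')"
    by simp
  then have "\<beta>' - \<beta> \<in> forms01 n e f p"
    using forms01_diff[OF assms(2)] \<beta>' by metis
  then have "\<beta>' - \<beta> = 0"
    using forms10_inter_forms01 forms10_diff assms(1) \<beta>' by blast
  then show "\<beta>' = \<beta>"
    by simp
qed (use assms in auto)

lemma part10_eq_0_iff:
  assumes "linear_within T \<gamma>" "\<And>v. v \<notin> T \<Longrightarrow> \<gamma> v = 0" "\<gamma> r = 0"
  shows "part10 n e f p \<gamma> = 0 \<longleftrightarrow> \<gamma> \<in> forms01 n e f p"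
proof
  assume 0: "part10 n e f p \<gamma> = 0"
  define b where "b i = (\<gamma> (E i p) - \<i> * \<gamma> (F i p)) / sqrt 2" for i
  define c where "c i = (\<gamma> (E i p) + \<i> * \<gamma> (F i p)) / sqrt 2" for i
  let ?\<beta> = "\<lambda>v. \<Sum>i=1..n. b i * theta e f i p v"
  have "\<gamma> v = ?\<beta> v + (\<Sum>i=1..n. c i * cnj (theta e f i p v))" for v
    unfolding b_def c_def by (rule fun_cong[OF type_decomposition[OF assms]])
  then have "\<gamma> - ?\<beta> = (\<lambda>v. \<Sum>i=1..n. c i * cnj (theta e f i p v))"
    by (simp add: fun_eq_iff)
  then have "\<gamma> - ?\<beta> \<in> forms01 n e f p"
    by (simp only: forms01I)
  moreover have "?\<beta> \<in> forms10 n e f p"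
    by (rule forms10I)
  ultimately have "?\<beta> = 0" "\<gamma> - ?\<beta> \<in> forms01 n e f p"
    using part10_eqI 0 by auto
  then show "\<gamma> \<in> forms01 n e f p"
    by simp
next
  assume "\<gamma> \<in> forms01 n e f p"
  moreover have "0 \<in> forms10 n e f p"
    by (auto simp: forms10_def fun_eq_iff intro!: exI[of _ "\<lambda>_. 0"])
  ultimately show "part10 n e f p \<gamma> = 0"
    by (intro part10_eqI) auto
qed

text \<open>Antilinearity on \<open>\<xi>\<close> makes every \<open>\<gamma>(\<eta>\<^sub>i)\<close> vanish, because \<open>F\<^sub>i = J E\<^sub>i\<close>, and these are
  the coefficients of the \<open>(1,0)\<close>-part.\<close>

lemma forms01_iff_antilinear:
  assumes "linear_within T \<gamma>" "\<And>v. v \<notin> T \<Longrightarrow> \<gamma> v = 0" "\<gamma> r = 0"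
  shows "\<gamma> \<in> forms01 n e f p \<longleftrightarrow> (\<forall>v\<in>T. l v = 0 \<longrightarrow> \<gamma> (I v) = - \<i> * \<gamma> v)"
proof
  assume "\<forall>v\<in>T. l v = 0 \<longrightarrow> \<gamma> (I v) = - \<i> * \<gamma> v"
  then have F: "\<gamma> (F i p) = - \<i> * \<gamma> (E i p)" if "i \<in> {1..n}" for i
    using that frame_in_T(1) I_frame(1) l_frame(1) by metis
  have "\<gamma> (E i p) - \<i> * \<gamma> (F i p) = 0" if "i \<in> {1..n}" for i
    unfolding F[OF that] by simp
  then have "(\<Sum>i=1..n. (\<gamma> (E i p) - \<i> * \<gamma> (F i p)) / sqrt 2 * theta e f i p v) = 0" for v
    by (intro sum.neutral) simp
  moreover define c where "c i = (\<gamma> (E i p) + \<i> * \<gamma> (F i p)) / sqrt 2" for i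
  ultimately have "\<gamma> v = (\<Sum>i=1..n. c i * cnj (theta e f i p v))" for v
    using fun_cong[OF type_decomposition[OF assms], of v] by simp
  then have "\<gamma> = (\<lambda>v. \<Sum>i=1..n. c i * cnj (theta e f i p v))"
    by (rule ext)
  then show "\<gamma> \<in> forms01 n e f p"
    by (simp only: forms01I)
qed (use forms01_J in auto)

end


section \<open>The connection forms of the Reeb field\<close>

lemma almost_contact_frame_atI:
  fixes A :: "('a::{t2_space, second_countable_topology}, 'e::euclidean_space) chart set"
  assumes triad: "contact_triad A n lam R J"
    and frame: "almost_contact_frame A n lam R J U E F"
    and coframe: "dual_coframe A n R U E F e f" and p: "p \<in> U"
  shows "almost_contact_frame_at (tangent A p) (lam p) (R p) (J p) n p E F e f"
proof
  have "one_form A UNIV lam" and R: "reeb_field A lam R" and J: "contact_complex_structure A lam R J"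
    using triad by (auto simp: contact_triad_def contact_form_def)
  then show "linear_within (tangent A p) (lam p)"
    by (simp add: one_form_def covectors_def linear_within_def)
  show "linear_within (tangent A p) (J p)" "J p (R p) = 0"
    using J by (simp_all add: contact_complex_structure_def linear_within_def)
  show "lam p (R p) = 1"
    using R by (simp add: reeb_field_def)
  show "span ((\<lambda>i. E i p) ` {1..n} \<union> (\<lambda>i. F i p) ` {1..n} \<union> {R p}) = tangent A p"
    using frame p unfolding almost_contact_frame_def by blast
  fix i
  assume i: "i \<in> {1..n}"
  have E: "E i p \<in> contact_dist A lam p" and F: "F i p = J p (E i p)"
    using frame p i by (auto simp: almost_contact_frame_def)
  then show "J p (E i p) = F i p" "J p (F i p) = - E i p" "lam p (E i p) = 0" "lam p (F i p) = 0"
    using J unfolding contact_complex_structure_def contact_dist_def by auto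
  show "linear_within (tangent A p) (e i p)" "linear_within (tangent A p) (f i p)"
    "v \<notin> tangent A p \<Longrightarrow> e i p v = 0" "v \<notin> tangent A p \<Longrightarrow> f i p v = 0" for v
    using coframe p i by (auto simp: dual_coframe_def one_form_def covectors_def linear_within_def)
  show "e i p (R p) = 0" "f i p (R p) = 0"
    using coframe p i by (auto simp: dual_coframe_def)
  show "e i p (E j p) = of_bool (i = j)" "e i p (F j p) = 0"
    "f i p (E j p) = 0" "f i p (F j p) = of_bool (i = j)" if "j \<in> {1..n}" for j
    using coframe p i that by (auto simp: dual_coframe_def)
qed

text \<open>Writing the defining equation in real terms, \<open>\<nabla>\<^sub>vR\<close> is \<open>\<surd>2\<close> times the sum of the
  \<open>Re \<alpha>\<^sub>k(v) E\<^sub>k + Im \<alpha>\<^sub>k(v) F\<^sub>k\<close>.\<close>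

lemma theta_nabla_reeb:
  fixes A :: "('a::{t2_space, second_countable_topology}, 'e::euclidean_space) chart set"
  assumes at: "almost_contact_frame_at (tangent A p) l r I n p E F e f"
    and forms: "connection_forms A n R nabla U E F \<alpha>"
    and "p \<in> U" "v \<in> tangent A p" and k: "k \<in> {1..n}"
  shows "theta e f k p (nabla p v R) = \<alpha> k p v"
proof -
  have "nabla p v R = (\<Sum>k=1..n. (sqrt 2 * Re (\<alpha> k p v)) *\<^sub>R E k p) +
      (\<Sum>k=1..n. (sqrt 2 * Im (\<alpha> k p v)) *\<^sub>R F k p)" (is "_ = ?w")
  proof
    fix h
    have 2: "2 * x / sqrt 2 = sqrt 2 * x" for x :: real
      by (simp add: field_simps flip: real_sqrt_mult)
    have "complex_of_real (nabla p v R h) =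
        (\<Sum>k=1..n. \<alpha> k p v * eta E F k p h + cnj (\<alpha> k p v * eta E F k p h))"
      using forms assms(3,4) by (simp add: connection_forms_def sum.distrib)
    also have "\<dots> = of_real (\<Sum>k=1..n. 2 * Re (\<alpha> k p v * eta E F k p h))"
      by (simp only: complex_add_cnj of_real_sum)
    finally have "nabla p v R h = (\<Sum>k=1..n. 2 * Re (\<alpha> k p v * eta E F k p h))"
      by (simp only: of_real_eq_iff)
    also have "\<dots> = (\<Sum>k=1..n. sqrt 2 * Re (\<alpha> k p v) * E k p h + sqrt 2 * Im (\<alpha> k p v) * F k p h)"
    proof (intro sum.cong refl)
      fix k
      have "2 * Re (\<alpha> k p v * eta E F k p h) =
          2 * (Re (\<alpha> k p v) * E k p h + Im (\<alpha> k p v) * F k p h) / sqrt 2"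
        by (simp add: eta_def add_divide_distrib)
      then show "2 * Re (\<alpha> k p v * eta E F k p h) =
          sqrt 2 * Re (\<alpha> k p v) * E k p h + sqrt 2 * Im (\<alpha> k p v) * F k p h"
        unfolding 2 by (simp add: algebra_simps)
    qed
    finally show "nabla p v R h = ?w h"
      by (simp add: sum_fun_apply scaleR_fun_def sum.distrib)
  qed
  then have "theta e f k p (nabla p v R) =
      (of_real (sqrt 2 * Re (\<alpha> k p v)) + \<i> * of_real (sqrt 2 * Im (\<alpha> k p v))) / sqrt 2"
    using almost_contact_frame_at.theta_combination[OF at k] by simp
  also have "\<dots> = \<alpha> k p v"
    by (simp add: complex_eq_iff)
  finally show ?thesis .
qed

theorem proposition1p9:
  fixes A :: "('a::{t2_space, second_countable_topology}, 'e::euclidean_space) chart set"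
    and n :: nat
    and lam :: "'a form1"
    and R :: "'a vfield"
    and J :: "'a \<Rightarrow> 'a tvec \<Rightarrow> 'a tvec"
    and nabla :: "'a connection"
    and U :: "'a set"
    and E F :: "nat \<Rightarrow> 'a vfield"
    and e f :: "nat \<Rightarrow> 'a form1"
    and \<alpha> :: "nat \<Rightarrow> 'a cform1"
  assumes "contact_triad A n lam R J"
    and "affine_connection A nabla"
    and "triad_connection_axioms A lam R J nabla"
    and "almost_contact_frame A n lam R J U E F"
    and "dual_coframe A n R U E F e f"
    and "connection_forms A n R nabla U E F \<alpha>"
  shows "(\<forall>k\<in>{1..n}. \<forall>p\<in>U. perp_part lam R (\<alpha> k) p = 0) \<and>
    ((\<forall>p\<in>U. \<forall>v\<in>contact_dist A lam p. nabla p (J p v) R + J p (nabla p v R) = 0) \<longleftrightarrow>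
     (\<forall>k\<in>{1..n}. \<forall>p\<in>U. part10 n e f p (pi_part lam R (\<alpha> k) p) = 0)) \<and>
    ((\<forall>k\<in>{1..n}. \<forall>p\<in>U. part10 n e f p (pi_part lam R (\<alpha> k) p) = 0) \<longleftrightarrow>
     (\<forall>k\<in>{1..n}. \<forall>p\<in>U. pi_part lam R (\<alpha> k) p \<in> forms01 n e f p))"
proof -
  have R: "smooth_vfield A UNIV R"
    using assms(1) by (simp add: contact_triad_def reeb_field_def)
  have J: "J p v \<in> contact_dist A lam p" if "v \<in> contact_dist A lam p" for p v
    using assms(1) that by (simp add: contact_triad_def contact_complex_structure_def)
  have nabla_RR: "nabla p (R p) R = 0"
    and nabla_R: "v \<in> contact_dist A lam p \<Longrightarrow> nabla p v R \<in> contact_dist A lam p" for p v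
    using assms(3) by (auto simp: triad_connection_axioms_def)
  note at = almost_contact_frame_atI[OF assms(1,4,5)]
  note theta_nabla = theta_nabla_reeb[OF at assms(6)]
  have R_tangent: "R p \<in> tangent A p" for p
    using R by (simp add: smooth_vfield_def)
  have \<alpha>_linear: "linear_within (tangent A p) (\<alpha> k p)"
    and \<alpha>_outside: "v \<notin> tangent A p \<Longrightarrow> \<alpha> k p v = 0" if "k \<in> {1..n}" "p \<in> U" for k p v
    using assms(6) that
    by (auto simp: connection_forms_def complex_one_form_def one_form_def covectors_def
        linear_within_def complex_eq_iff)
  have \<alpha>_R: "\<alpha> k p (R p) = 0" if k: "k \<in> {1..n}" and p: "p \<in> U" for k p
  proof -
    interpret almost_contact_frame_at "tangent A p" "lam p" "R p" "J p" n p E F e f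
      by (rule at[OF p])
    have "theta e f k p 0 = 0"
      using linear_withinD[OF theta_linear[OF k], of "R p" "R p" 0 0] R_tangent by simp
    then show ?thesis
      using theta_nabla[OF p p R_tangent k] nabla_RR by simp
  qed
  have perp: "perp_part lam R (\<alpha> k) p = 0" if "k \<in> {1..n}" "p \<in> U" for k p
    using \<alpha>_R[OF that] by (simp add: perp_part_def fun_eq_iff)
  then have pi: "pi_part lam R (\<alpha> k) p = \<alpha> k p" if "k \<in> {1..n}" "p \<in> U" for k p
    using that by (simp add: pi_part_def)
  have part10: "part10 n e f p (\<alpha> k p) = 0 \<longleftrightarrow> \<alpha> k p \<in> forms01 n e f p"
    if "k \<in> {1..n}" "p \<in> U" for k p
  proof -
    interpret almost_contact_frame_at "tangent A p" "lam p" "R p" "J p" n p E F e f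
      by (rule at[OF that(2)])
    show ?thesis
      by (intro part10_eq_0_iff \<alpha>_linear \<alpha>_outside \<alpha>_R that)
  qed
  have antilinear: "\<alpha> k p \<in> forms01 n e f p \<longleftrightarrow>
      (\<forall>v\<in>contact_dist A lam p. \<alpha> k p (J p v) = - \<i> * \<alpha> k p v)"
    if "k \<in> {1..n}" "p \<in> U" for k p
  proof -
    interpret almost_contact_frame_at "tangent A p" "lam p" "R p" "J p" n p E F e f
      by (rule at[OF that(2)])
    have "\<alpha> k p \<in> forms01 n e f p \<longleftrightarrow>
        (\<forall>v\<in>tangent A p. lam p v = 0 \<longrightarrow> \<alpha> k p (J p v) = - \<i> * \<alpha> k p v)"
      by (intro forms01_iff_antilinear \<alpha>_linear \<alpha>_outside \<alpha>_R that)
    then show ?thesis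
      by (auto simp: contact_dist_def)
  qed
  \<comment> \<open>Apply all \<open>\<theta>\<^sup>k\<close> to the left-hand side, which lies in \<open>\<xi>\<close> and hence is determined by them.\<close>
  have nabla_iff: "nabla p (J p v) R + J p (nabla p v R) = 0 \<longleftrightarrow>
      (\<forall>k\<in>{1..n}. \<alpha> k p (J p v) = - \<i> * \<alpha> k p v)"
    if p: "p \<in> U" and v: "v \<in> contact_dist A lam p" for p v
  proof -
    interpret almost_contact_frame_at "tangent A p" "lam p" "R p" "J p" n p E F e f
      by (rule at[OF p])
    let ?w = "nabla p (J p v) R + J p (nabla p v R)"
    have xi: "nabla p (J p v) R \<in> contact_dist A lam p" "J p (nabla p v R) \<in> contact_dist A lam p"
      using v J nabla_R by auto
    then have T: "nabla p (J p v) R \<in> tangent A p" "J p (nabla p v R) \<in> tangent A p"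
      by (auto simp: contact_dist_def)
    have w: "?w \<in> tangent A p" "lam p ?w = 0"
      using xi linear_withinD[OF l_linear T, of 1 1] subspace_add[OF subspace_T T]
      by (auto simp: contact_dist_def)
    have theta_w: "theta e f k p ?w = \<alpha> k p (J p v) + \<i> * \<alpha> k p v" if k: "k \<in> {1..n}" for k
    proof -
      have v': "v \<in> tangent A p" "J p v \<in> tangent A p" "nabla p v R \<in> tangent A p"
        using v J nabla_R by (auto simp: contact_dist_def)
      have "theta e f k p ?w = theta e f k p (nabla p (J p v) R) + theta e f k p (J p (nabla p v R))"
        using linear_withinD[OF theta_linear[OF k] T, of 1 1] by simp
      then show ?thesis
        using theta_nabla[OF p p _ k] v' theta_J[OF k] by simp
    qed
    have theta_0: "theta e f k p 0 = 0" if "k \<in> {1..n}" for k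
      using linear_withinD[OF theta_linear[OF that], of "R p" "R p" 0 0] R_tangent by simp
    have "?w = 0 \<longleftrightarrow> (\<forall>k\<in>{1..n}. theta e f k p ?w = 0)"
      using eq_0_if_theta_eq_0[OF w] theta_0 by auto
    then show ?thesis
      by (simp add: theta_w add_eq_0_iff2)
  qed
  have "(\<forall>p\<in>U. \<forall>v\<in>contact_dist A lam p. nabla p (J p v) R + J p (nabla p v R) = 0) \<longleftrightarrow>
      (\<forall>k\<in>{1..n}. \<forall>p\<in>U. \<alpha> k p \<in> forms01 n e f p)"
    using nabla_iff antilinear by auto
  then show ?thesis
    using perp pi part10 by auto
qed

end
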